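(* Let $0\le\alpha<1$ and let $h(z)=z+\sum_{n=2}^{\infty}a_nz^n$ and $g(z)=\sum_{n=1}^{\infty}b_nz^n$ be power series whose coefficients satisfy (with $a_1=1$) $$|a_n|\le\tfrac16(2n+1)(n+1)\quad\text{and}\quad |b_n|\le\tfrac16(2n-1)(n-1)\qquad\text{for all } n\ge1.$$ Then $f=h+\overline{g}$ is univalent and fully convex of order $\alpha$ in the disk $|z|<r_C$, where $r_C=r_C(\alpha)$ is the real root of the equation $$2(1-\alpha)(1-r)^5+\alpha(1+r)(1-r)^2-(1+r)(r^2+6r+1)=0$$ in the interval $(0,1)$. In particular, $f$ is univalent and fully convex in $|z|<r_C(0)\approx0.0614313$.
   Context: A complex-valued harmonic function $f$ is said to be fully convex of order $\alpha$ ($0\le\alpha<1$) in a disk $|z|<\rho$ if, for every $0<r<\rho$, $f$ maps the circle $|z|=r$ in a one-to-one manner onto a convex curve satisfying $\frac{\partial}{\partial\theta}\left(\arg\left\{\frac{\partial}{\partial\theta}f(re^{i\theta})\right\}\right)>\alpha$ for $0\le\theta\le2\pi$. Fully convex means fully convex of order $0$. *)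

theory Defs
  imports "HOL-Analysis.Analysis"
begin

text \<open>Complex-valued harmonic functions of \<open>z = x + i y\<close>: twice continuously differentiable in
  the real sense, with vanishing Laplacian. Here \<open>p, q\<close> are the first partial derivatives in
  \<open>x, y\<close>, the functions \<open>pxx, pxy\<close> those of \<open>p\<close>, and \<open>qyx, qyy\<close> those of \<open>q\<close>.\<close>

definition harmonic_fun_on :: "(complex \<Rightarrow> complex) \<Rightarrow> complex set \<Rightarrow> bool" where
  "harmonic_fun_on f S \<longleftrightarrow> open S \<and>
     (\<exists>p q pxx pxy qyx qyy.
        continuous_on S pxx \<and> continuous_on S pxy \<and> continuous_on S qyx \<and> continuous_on S qyy \<and>
        (\<forall>z\<in>S. (f has_derivative (\<lambda>v. Re v *\<^sub>R p z + Im v *\<^sub>R q z)) (at z) \<and>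
               (p has_derivative (\<lambda>v. Re v *\<^sub>R pxx z + Im v *\<^sub>R pxy z)) (at z) \<and>
               (q has_derivative (\<lambda>v. Re v *\<^sub>R qyx z + Im v *\<^sub>R qyy z)) (at z) \<and>
               pxx z + qyy z = 0))"

text \<open>A (closed) convex curve is the boundary of a bounded convex domain.\<close>

definition convex_curve :: "complex set \<Rightarrow> bool" where
  "convex_curve C \<longleftrightarrow>
     (\<exists>D. open D \<and> convex D \<and> bounded D \<and> D \<noteq> {} \<and> C = frontier D)"

text \<open>A continuous branch \<open>\<phi>\<close> of \<open>arg w(t)\<close> along a nowhere vanishing \<open>w\<close>. Any two
  branches differ by a constant, so the derivative of \<open>arg w(t)\<close> does not depend on the branch.
  The principal value \<open>Arg\<close> would not do, because of its jumps.\<close>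

definition arg_branch :: "(real \<Rightarrow> complex) \<Rightarrow> (real \<Rightarrow> real) \<Rightarrow> bool" where
  "arg_branch w \<phi> \<longleftrightarrow> continuous_on UNIV \<phi> \<and>
     (\<forall>t. w t \<noteq> 0 \<and> w t = rcis (norm (w t)) (\<phi> t))"

definition circle_deriv :: "(complex \<Rightarrow> complex) \<Rightarrow> real \<Rightarrow> real \<Rightarrow> complex" where
  "circle_deriv f r \<theta> = vector_derivative (\<lambda>t. f (rcis r t)) (at \<theta>)"

definition fully_convex_of_order :: "real \<Rightarrow> (complex \<Rightarrow> complex) \<Rightarrow> real \<Rightarrow> bool" where
  "fully_convex_of_order \<alpha> f \<rho> \<longleftrightarrow> harmonic_fun_on f (ball 0 \<rho>) \<and>
     (\<forall>r. 0 < r \<and> r < \<rho> \<longrightarrow>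
        inj_on f (sphere 0 r) \<and> convex_curve (f ` sphere 0 r) \<and>
        (\<exists>\<phi>. arg_branch (circle_deriv f r) \<phi> \<and>
             (\<forall>\<theta>\<in>{0..2*pi}. \<phi> differentiable (at \<theta>) \<and> deriv \<phi> \<theta> > \<alpha>)))"

abbreviation fully_convex :: "(complex \<Rightarrow> complex) \<Rightarrow> real \<Rightarrow> bool" where
  "fully_convex \<equiv> fully_convex_of_order 0"

definition is_rC :: "real \<Rightarrow> real \<Rightarrow> bool" where
  "is_rC \<alpha> r \<longleftrightarrow> 0 < r \<and> r < 1 \<and>
     2 * (1 - \<alpha>) * (1 - r)^5 + \<alpha> * (1 + r) * (1 - r)^2 - (1 + r) * (r^2 + 6 * r + 1) = 0"

definition rC :: "real \<Rightarrow> real" where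
  "rC \<alpha> = (THE r. is_rC \<alpha> r)"

end

theory Submission
  imports Defs "HOL-Complex_Analysis.Cauchy_Integral_Formula" "HOL-Library.Periodic_Fun"
begin

text \<open>
On the circle of radius \<open>r\<close> the tangent of \<open>f = h + cnj g\<close> is \<open>\<i> * D\<close> with
\<open>D = z * h' - cnj (z * g')\<close>. If \<open>D\<close> stays in the right half plane after being rotated back by the
angle of \<open>z\<close>, the tangent has a continuous argument that makes one turn, and this argument
increases at the rate \<open>Re (N / D)\<close> with \<open>N = z * (z * h')' + cnj (z * (z * g')')\<close>.

Both \<open>Re (N / D) > \<alpha>\<close> and the position of \<open>D\<close>, as well as univalence in the disc of radius \<open>r\<close>,
follow from the single inequality
\<open>\<Sum> (n * (n - \<alpha>) * \<bar>a\<^sub>n\<bar> + n * (n + \<alpha>) * \<bar>b\<^sub>n\<bar>) * r^n < 2 * (1 - \<alpha>) * r\<close>, in which the linear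
term accounts for half of the right-hand side and so dominates all others (\<open>Re_N_div_D\<close>, \<open>D_close\<close>, \<open>inj_on_f\<close>).
Under the given coefficient bounds the left-hand side is at most an explicit combination of
\<open>\<Sum> n^4 * r^n\<close> and \<open>\<Sum> n^2 * r^n\<close>. Inserting the closed forms and clearing denominators produces the
polynomial of the radius equation, which decreases strictly on the unit interval; so the
inequality holds for every \<open>r\<close> below its root (\<open>coefficient_condition\<close>).

That a curve with such a tangent bounds a convex domain is a fact about plane curves
(\<open>convex_curve_if_tangent_turns_once\<close>): every tangent line supports the curve strictly, every
direction occurs as an outer normal, and therefore the boundary of the convex hull is the curve itself.
\<close>

section \<open>Closed curves with a monotone tangent\<close>

lemma cis_inner: "cis a \<bullet> cis b = cos (a - b)"
  by (simp add: inner_complex_def cos_diff)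

text \<open>The height of the curve in the direction of the outer normal at \<open>\<theta>\<close> has derivative
\<open>- norm (w t) * sin (\<phi> t - \<phi> \<theta>)\<close>. During one turn the angle \<open>\<phi> t - \<phi> \<theta>\<close>
increases from \<open>0\<close> to \<open>2 * pi\<close>, so the height first falls and then rises back to
its starting value: it stays strictly below that value in between.\<close>

lemma strict_support:
  fixes \<gamma> w :: "real \<Rightarrow> complex" and \<phi> :: "real \<Rightarrow> real"
  assumes deriv: "\<And>t. (\<gamma> has_vector_derivative w t) (at t)"
    and branch: "arg_branch w \<phi>"
    and mono: "strict_mono \<phi>"
    and turn: "\<And>t. \<phi> (t + 2*pi) = \<phi> t + 2*pi"
    and closed: "\<And>t. \<gamma> (t + 2*pi) = \<gamma> t"
    and s: "\<theta> < s" "s < \<theta> + 2*pi"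
  shows "cis (\<phi> \<theta> - pi/2) \<bullet> \<gamma> s < cis (\<phi> \<theta> - pi/2) \<bullet> \<gamma> \<theta>"
proof -
  define F where "F = (\<lambda>t. \<gamma> t \<bullet> cis (\<phi> \<theta> - pi/2))"
  have w: "w t \<noteq> 0" "w t = norm (w t) *\<^sub>R cis (\<phi> t)" for t
    using branch by (auto simp: arg_branch_def rcis_def scaleR_conv_of_real)
  have "(F has_vector_derivative (w t \<bullet> cis (\<phi> \<theta> - pi/2))) (at t)" for t
    unfolding F_def by (rule bounded_linear.has_vector_derivative[OF bounded_linear_inner_left deriv])
  moreover have "w t \<bullet> cis (\<phi> \<theta> - pi/2) = - norm (w t) * sin (\<phi> t - \<phi> \<theta>)" for t
  proof -
    have "w t \<bullet> cis (\<phi> \<theta> - pi/2) = norm (w t) * cos ((\<phi> t - \<phi> \<theta>) + pi/2)"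
      by (subst w(2)) (simp add: cis_inner algebra_simps)
    then show ?thesis by (simp add: cos_add)
  qed
  ultimately have F': "(F has_real_derivative - norm (w t) * sin (\<phi> t - \<phi> \<theta>)) (at t)" for t
    by (simp add: has_real_derivative_iff_has_vector_derivative)
  have contF: "continuous_on S F" for S
    using F' by (meson DERIV_isCont continuous_at_imp_continuous_on)
  \<comment> \<open>the height in that direction is lowest where the tangent is antiparallel to the one at \<open>\<theta>\<close>\<close>
  have "\<exists>m\<ge>\<theta>. m \<le> \<theta> + 2*pi \<and> \<phi> m = \<phi> \<theta> + pi"
    using branch turn by (intro IVT') (auto simp: arg_branch_def intro: continuous_on_subset)
  then obtain m where m: "\<theta> \<le> m" "m \<le> \<theta> + 2*pi" "\<phi> m = \<phi> \<theta> + pi" by blast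
  have less: "\<phi> x < \<phi> y" if "x < y" for x y
    using mono that by (simp add: strict_mono_less)
  have m': "\<theta> < m" "m < \<theta> + 2*pi"
    using m turn[of \<theta>] by (auto simp: less_le)
  have "F s < F \<theta>"
  proof (cases "s \<le> m")
    case True
    show ?thesis
    proof (rule DERIV_neg_imp_decreasing_open[OF s(1) _ contF])
      fix t assume t: "\<theta> < t" "t < s"
      then have "0 < sin (\<phi> t - \<phi> \<theta>)"
        using less[of \<theta> t] less[of t m] m True by (intro sin_gt_zero) auto
      then show "\<exists>y. (F has_real_derivative y) (at t) \<and> y < 0"
        using F'[of t] w(1)[of t] by (intro exI[of _ "- norm (w t) * sin (\<phi> t - \<phi> \<theta>)"]) simp
    qed
  next
    case False
    have "F s < F (\<theta> + 2*pi)"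
    proof (rule DERIV_pos_imp_increasing_open[OF s(2) _ contF])
      fix t assume t: "s < t" "t < \<theta> + 2*pi"
      then have "sin (\<phi> t - \<phi> \<theta>) < 0"
        using less[of m t] less[of t "\<theta> + 2*pi"] m False turn[of \<theta>]
        by (intro sin_lt_zero) auto
      then show "\<exists>y. (F has_real_derivative y) (at t) \<and> y > 0"
        using F'[of t] w(1)[of t]
        by (intro exI[of _ "- norm (w t) * sin (\<phi> t - \<phi> \<theta>)"]) (simp add: mult_pos_neg)
    qed
    then show ?thesis by (simp add: F_def closed)
  qed
  then show ?thesis by (simp add: F_def inner_commute)
qed

text \<open>If every direction attains its maximum over \<open>C\<close> at a single point, and each point of \<open>C\<close>
is such a maximiser, then the convex hull adds no further boundary points: a supporting line at a
boundary point \<open>x\<close> touches \<open>C\<close> in one point \<open>c\<close> only, hence touches the hull only there, and \<open>x = c\<close>.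
A second point in \<open>C\<close> is what makes the hull have interior.\<close>

lemma frontier_convex_eq_exposed:
  fixes C :: "'a::euclidean_space set"
  assumes "compact C"
    and expose: "\<And>p. p \<in> C \<Longrightarrow> \<exists>u. \<forall>x\<in>C - {p}. u \<bullet> x < u \<bullet> p"
    and attain: "\<And>u. u \<noteq> 0 \<Longrightarrow> \<exists>p\<in>C. \<forall>x\<in>C - {p}. u \<bullet> x < u \<bullet> p"
    and two: "p \<in> C" "q \<in> C" "p \<noteq> q"
  shows "interior (convex hull C) \<noteq> {}" and "C = frontier (interior (convex hull C))"
proof -
  define K where "K = convex hull C"
  have K: "compact K" "convex K" "closed K" "C \<subseteq> K"
    using assms(1) by (auto simp: K_def compact_convex_hull compact_imp_closed hull_subset)
  have hull_le: "u \<bullet> x < u \<bullet> p" if "\<forall>x\<in>C - {p}. u \<bullet> x < u \<bullet> p" "x \<in> K" "x \<noteq> p" for u p x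
  proof -
    \<comment> \<open>an open half space together with one point of its boundary is convex\<close>
    define H where "H = insert p {x. u \<bullet> x < u \<bullet> p}"
    have "convex H"
    proof (rule convexI)
      fix x y :: 'a and s t :: real
      assume xy: "x \<in> H" "y \<in> H" and st: "0 \<le> s" "0 \<le> t" "s + t = 1"
      have le: "u \<bullet> x \<le> u \<bullet> p" "u \<bullet> y \<le> u \<bullet> p" using xy by (auto simp: H_def)
      show "s *\<^sub>R x + t *\<^sub>R y \<in> H"
      proof (cases "s *\<^sub>R x + t *\<^sub>R y = p")
        case False
        have "u \<bullet> p = s * (u \<bullet> p) + t * (u \<bullet> p)"
          using st(3) by (metis distrib_right mult_1)
        moreover have "s * (u \<bullet> x) + t * (u \<bullet> y) < s * (u \<bullet> p) + t * (u \<bullet> p)"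
        proof -
          consider "s = 0" | "t = 0" | "s > 0" "t > 0" using st by fastforce
          then show ?thesis
          proof cases
            case 1 then have "t = 1" "y \<noteq> p" using st False by auto
            then show ?thesis using xy 1 by (auto simp: H_def)
          next
            case 2 then have "s = 1" "x \<noteq> p" using st False by auto
            then show ?thesis using xy 2 by (auto simp: H_def)
          next
            case 3
            have "x \<noteq> p \<or> y \<noteq> p"
              using False st(3) by (metis scaleR_add_left scaleR_one)
            then have "u \<bullet> x < u \<bullet> p \<or> u \<bullet> y < u \<bullet> p" using xy by (auto simp: H_def)
            then show ?thesis using le 3
              by (meson add_le_less_mono add_less_le_mono mult_left_mono mult_strict_left_mono less_imp_le)
          qed
        qed
        ultimately show ?thesis by (simp add: H_def inner_add_right)
      qed (simp add: H_def)
    qed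
    moreover have "C \<subseteq> H" using that(1) by (auto simp: H_def)
    ultimately have "K \<subseteq> H" by (simp add: K_def hull_minimal)
    then show ?thesis using that by (auto simp: H_def)
  qed
  have C_frontier: "p \<in> frontier K" if "p \<in> C" for p
  proof -
    obtain u where u: "\<forall>x\<in>C - {p}. u \<bullet> x < u \<bullet> p" using expose[OF \<open>p \<in> C\<close>] by blast
    obtain q where "q \<in> C" "q \<noteq> p" using two by blast
    then have "u \<noteq> 0" using u by auto
    have "p \<notin> interior K"
    proof
      assume "p \<in> interior K"
      then obtain e where e: "e > 0" "cball p e \<subseteq> K"
        by (meson mem_interior_cball)
      define x where "x = p + (e / norm u) *\<^sub>R u"
      have "x \<in> K" using e \<open>u \<noteq> 0\<close> by (intro subsetD[OF e(2)]) (simp add: x_def dist_norm)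
      moreover have "x \<noteq> p" using e(1) \<open>u \<noteq> 0\<close> by (simp add: x_def)
      ultimately have "u \<bullet> x < u \<bullet> p" using hull_le u by blast
      moreover have "u \<bullet> x \<ge> u \<bullet> p" using e(1) by (simp add: x_def inner_add_right)
      ultimately show False by simp
    qed
    then show ?thesis using \<open>p \<in> C\<close> K closure_subset by (auto simp: frontier_def)
  qed
  \<comment> \<open>no point of \<open>C\<close> lies between two others, so the hull has a point outside \<open>C\<close>,
    and that point turns out to be interior\<close>
  have not_C: "midpoint p q \<notin> C"
  proof
    assume m: "midpoint p q \<in> C"
    obtain u where u: "\<forall>x\<in>C - {midpoint p q}. u \<bullet> x < u \<bullet> midpoint p q"
      using expose[OF m] by blast
    have "p \<noteq> midpoint p q" "q \<noteq> midpoint p q"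
      using two(3) midpoint_eq_endpoint by metis+
    then have "u \<bullet> p < u \<bullet> midpoint p q" "u \<bullet> q < u \<bullet> midpoint p q"
      using u two by auto
    then show False by (simp add: midpoint_def inner_add_right)
  qed
  have frontier_C: "x \<in> C" if x: "x \<in> frontier K" for x
  proof -
    have xK: "x \<in> K" "x \<notin> interior K" using x K(3) by (auto simp: frontier_def)
    have "\<exists>a. a \<noteq> 0 \<and> (\<forall>y\<in>K. a \<bullet> x \<le> a \<bullet> y)"
    proof (cases "interior K = {}")
      case True
      then obtain a b where ab: "a \<noteq> 0" "K \<subseteq> {x. a \<bullet> x = b}"
        using empty_interior_subset_hyperplane[OF K(2)] by metis
      then show ?thesis using xK by (intro exI[of _ a]) (simp add: subset_iff)
    next
      case False
      have "x \<notin> rel_interior K" using False xK(2) by (simp add: rel_interior_nonempty_interior)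
      then show ?thesis
        using supporting_hyperplane_rel_boundary[OF K(2) xK(1)] by metis
    qed
    then obtain a where a: "a \<noteq> 0" "\<And>y. y \<in> K \<Longrightarrow> a \<bullet> x \<le> a \<bullet> y" by blast
    then obtain c where c: "c \<in> C" "\<forall>x\<in>C - {c}. (-a) \<bullet> x < (-a) \<bullet> c"
      using attain[of "-a"] by auto
    have "a \<bullet> x \<le> a \<bullet> c" using a c K by auto
    then have "x = c" using hull_le[OF c(2) xK(1)] by auto
    then show ?thesis using c by simp
  qed
  have "midpoint p q \<in> K"
    using two K(2,4) by (metis convex_contains_segment midpoint_in_closed_segment subsetD)
  then have int: "interior K \<noteq> {}"
    using not_C frontier_C K(3) by (auto simp: frontier_def)
  then show "interior (convex hull C) \<noteq> {}" by (simp add: K_def)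
  have "frontier (interior K) = frontier K"
    using int K(2) by (simp add: frontier_def convex_closure_interior)
  then show "C = frontier (interior (convex hull C))"
    using C_frontier frontier_C by (auto simp: K_def)
qed

text \<open>A closed curve whose tangent direction increases strictly and makes exactly one turn is the boundary
of a convex domain. By \<open>strict_support\<close> each point of the curve is strictly extremal in its outer
normal direction; since the direction makes a full turn, every direction is the normal at some
point, and \<open>frontier_convex_eq_exposed\<close> applies.\<close>

lemma convex_curve_if_tangent_turns_once:
  fixes \<gamma> w :: "real \<Rightarrow> complex" and \<phi> :: "real \<Rightarrow> real"
  assumes deriv: "\<And>t. (\<gamma> has_vector_derivative w t) (at t)"
    and branch: "arg_branch w \<phi>"
    and mono: "strict_mono \<phi>"
    and turn: "\<And>t. \<phi> (t + 2*pi) = \<phi> t + 2*pi"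
    and closed: "\<And>t. \<gamma> (t + 2*pi) = \<gamma> t"
  shows "convex_curve (range \<gamma>)"
proof -
  interpret periodic_fun_simple \<gamma> "2*pi" by standard (rule closed)
  have reduce: "\<exists>s. \<theta> \<le> s \<and> s < \<theta> + 2*pi \<and> \<gamma> t = \<gamma> s" for t \<theta>
  proof -
    define k where "k = \<lfloor>(t - \<theta>) / (2*pi)\<rfloor>"
    have "of_int k \<le> (t - \<theta>) / (2*pi)" "(t - \<theta>) / (2*pi) < of_int k + 1"
      unfolding k_def by linarith+
    then have "\<theta> \<le> t - of_int k * (2*pi)" "t - of_int k * (2*pi) < \<theta> + 2*pi"
      by (auto simp: field_simps)
    then show ?thesis using minus_of_int[of t k] by metis
  qed
  have support: "cis (\<phi> \<theta> - pi/2) \<bullet> x < cis (\<phi> \<theta> - pi/2) \<bullet> \<gamma> \<theta>"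
    if "x \<in> range \<gamma> - {\<gamma> \<theta>}" for x \<theta>
  proof -
    obtain t where t: "x = \<gamma> t" using \<open>x \<in> range \<gamma> - {\<gamma> \<theta>}\<close> by blast
    obtain s where s: "\<theta> \<le> s" "s < \<theta> + 2*pi" "x = \<gamma> s" using reduce t by metis
    then have "\<theta> < s" using that by (auto simp: less_le)
    then show ?thesis using strict_support[of \<gamma> w \<phi> \<theta> s, OF assms _ s(2)] s(3) by simp
  qed
  have "continuous_on S \<gamma>" for S
    using deriv by (meson continuous_at_imp_continuous_on has_vector_derivative_continuous)
  then have "compact (\<gamma> ` {0..2*pi})" by (intro compact_continuous_image) auto
  moreover have "range \<gamma> = \<gamma> ` {0..2*pi}"
    using reduce[of 0] by force
  ultimately have comp: "compact (range \<gamma>)" by simp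
  have "cis (\<phi> 0 - pi/2) \<bullet> \<gamma> pi < cis (\<phi> 0 - pi/2) \<bullet> \<gamma> 0"
    by (rule strict_support[of \<gamma> w \<phi> 0 pi, OF assms]) auto
  then have two: "\<gamma> pi \<noteq> \<gamma> 0" by auto
  have attain: "\<exists>p\<in>range \<gamma>. \<forall>x\<in>range \<gamma> - {p}. u \<bullet> x < u \<bullet> p" if "u \<noteq> 0" for u
  proof -
    define k where "k = \<lfloor>(Arg u + pi/2 - \<phi> 0) / (2*pi)\<rfloor>"
    \<comment> \<open>the angle of the tangent whose outer normal points along \<open>u\<close>, shifted into
      the range of \<open>\<phi>\<close> on one period\<close>
    define y where "y = Arg u + pi/2 - of_int k * (2*pi)"
    have "of_int k \<le> (Arg u + pi/2 - \<phi> 0) / (2*pi)" "(Arg u + pi/2 - \<phi> 0) / (2*pi) < of_int k + 1"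
      unfolding k_def by linarith+
    then have y: "\<phi> 0 \<le> y" "y \<le> \<phi> 0 + 2*pi"
      by (auto simp: y_def field_simps)
    have "\<exists>\<theta>\<ge>0. \<theta> \<le> 2*pi \<and> \<phi> \<theta> = y"
      using branch turn[of 0] y by (intro IVT') (auto simp: arg_branch_def intro: continuous_on_subset)
    then obtain \<theta> where \<theta>: "\<phi> \<theta> = y" by blast
    have "cis (Arg u + of_int (-k) * (2*pi)) = cis (Arg u)"
      by (metis cis_mult cis_multiple_2pi Ints_of_int mult.commute mult.right_neutral)
    then have "cis (\<phi> \<theta> - pi/2) = cis (Arg u)" by (simp add: \<theta> y_def algebra_simps)
    moreover have "u = norm u *\<^sub>R cis (Arg u)"
      using rcis_cmod_Arg[of u] by (simp add: rcis_def scaleR_conv_of_real)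
    ultimately have u: "u = norm u *\<^sub>R cis (\<phi> \<theta> - pi/2)" by simp
    have "u \<bullet> x < u \<bullet> \<gamma> \<theta>" if "x \<in> range \<gamma> - {\<gamma> \<theta>}" for x
      using support[OF that] \<open>u \<noteq> 0\<close> by (subst (1 2) u) simp
    then show ?thesis by blast
  qed
  have expose: "\<exists>u. \<forall>x\<in>range \<gamma> - {p}. u \<bullet> x < u \<bullet> p" if "p \<in> range \<gamma>" for p
    using that support by blast
  note * = frontier_convex_eq_exposed[OF comp expose attain _ _ two]
  have "bounded (interior (convex hull range \<gamma>))"
    using comp by (meson bounded_convex_hull bounded_subset compact_imp_bounded interior_subset)
  then show ?thesis
    unfolding convex_curve_def using *
    by (intro exI[of _ "interior (convex hull range \<gamma>)"]) auto
qed

section \<open>Power series and harmonic functions\<close>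

abbreviation power_series :: "(nat \<Rightarrow> 'a::{real_normed_field,banach}) \<Rightarrow> 'a \<Rightarrow> 'a" where
  "power_series c z \<equiv> (\<Sum>n. c n * z ^ n)"

definition converges_in_unit_disc :: "(nat \<Rightarrow> 'a::{real_normed_field,banach}) \<Rightarrow> bool" where
  "converges_in_unit_disc c \<longleftrightarrow> (\<forall>z. norm z < 1 \<longrightarrow> summable (\<lambda>n. c n * z ^ n))"

text \<open>The coefficients of \<open>z * F'(z)\<close> if \<open>c\<close> are those of \<open>F(z)\<close>. Differentiating
\<open>F (r * exp (\<i> * t))\<close> in \<open>t\<close> amounts to this operator and a factor \<open>\<i>\<close>, so on a circle
no other derivative is needed.\<close>

definition euler :: "(nat \<Rightarrow> 'a::ring_1) \<Rightarrow> nat \<Rightarrow> 'a" where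
  "euler c n = of_nat n * c n"

lemma euler_sums_if_diffs_sums:
  fixes z :: "'a::{real_normed_field,banach}"
  assumes "(\<lambda>n. diffs c n * z ^ n) sums s"
  shows "(\<lambda>n. euler c n * z ^ n) sums (z * s)"
proof -
  have "(\<lambda>n. euler c (Suc n) * z ^ Suc n) = (\<lambda>n. z * (diffs c n * z ^ n))"
    by (auto simp: euler_def diffs_def mult_ac)
  then have "(\<lambda>n. euler c (Suc n) * z ^ Suc n) sums (z * s)"
    using sums_mult[OF assms, of z] by simp
  then show ?thesis
    using sums_Suc_iff[of "\<lambda>n. euler c n * z ^ n" "z * s"] by (simp add: euler_def)
qed

lemma converges_diffs:
  "converges_in_unit_disc c \<Longrightarrow> norm z < 1 \<Longrightarrow> summable (\<lambda>n. diffs c n * z ^ n)"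
  unfolding converges_in_unit_disc_def by (rule termdiff_converges[of z 1]) auto

lemma power_series_euler:
  assumes "converges_in_unit_disc c" "norm z < 1"
  shows "power_series (euler c) z = z * power_series (diffs c) z"
  using euler_sums_if_diffs_sums[OF summable_sums[OF converges_diffs[OF assms]]] by (rule sums_unique[symmetric])

lemma converges_euler:
  "converges_in_unit_disc c \<Longrightarrow> converges_in_unit_disc (euler c)"
  using euler_sums_if_diffs_sums[OF summable_sums[OF converges_diffs]]
  by (auto simp: converges_in_unit_disc_def[of "euler c"] intro: sums_summable)

lemma power_series_DERIV:
  assumes "converges_in_unit_disc c" "norm z < 1"
  shows "(power_series c has_field_derivative power_series (diffs c) z) (at z)"
  using assms by (intro termdiffs_strong'[of 1]) (auto simp: converges_in_unit_disc_def)

lemma power_series_holomorphic_on_disc: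
  fixes c :: "nat \<Rightarrow> complex"
  assumes "converges_in_unit_disc c"
  shows "power_series c holomorphic_on ball 0 1"
proof (rule holomorphic_onI)
  fix z :: complex assume "z \<in> ball 0 1"
  then have "norm z < 1" by simp
  from has_field_derivative_at_within[OF power_series_DERIV[OF assms this]]
  show "power_series c field_differentiable at z within ball 0 1"
    unfolding field_differentiable_def by blast
qed

lemma power_series_on_circle:
  assumes "converges_in_unit_disc c" "\<bar>r\<bar> < 1"
  shows "((\<lambda>t. power_series c (rcis r t)) has_vector_derivative
           \<i> * power_series (euler c) (rcis r t)) (at t)"
proof -
  have z: "norm (rcis r t) < 1" using assms(2) by simp
  have "((\<lambda>t. rcis r t) has_vector_derivative \<i> * rcis r t) (at t)"
    unfolding rcis_def cis_conv_exp
    by (auto intro!: derivative_eq_intros has_vector_derivative_real_field)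
  from field_vector_diff_chain_at[OF this power_series_DERIV[OF assms(1) z]]
  show ?thesis by (simp add: o_def power_series_euler[OF assms(1) z] mult_ac)
qed

lemma summable_norm_power_series:
  assumes "converges_in_unit_disc c" "0 \<le> r" "r < 1"
  shows "summable (\<lambda>n. norm (c n) * r ^ n)"
proof -
  define s where "s = (1 + r) / 2"
  have s: "0 \<le> s" "s < 1" "r < s" using assms by (auto simp: s_def)
  then have "summable (\<lambda>n. c n * of_real s ^ n)"
    using assms(1) by (auto simp: converges_in_unit_disc_def)
  then have "summable (\<lambda>n. norm (c n * of_real r ^ n))"
    by (rule powser_insidea) (use s assms in auto)
  then show ?thesis using assms by (simp add: norm_mult norm_power)
qed

text \<open>The first partial derivatives are \<open>h' + cnj g'\<close> and \<open>\<i> * (h' - cnj g')\<close>; a second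
differentiation in the imaginary direction reproduces the second derivative in the real direction with
the opposite sign, because \<open>\<i> * \<i> = (-\<i>) * (-\<i>) = -1\<close>.\<close>

lemma harmonic_fun_on_holomorphic_plus_cnj:
  assumes "open S" "h holomorphic_on S" "g holomorphic_on S"
  shows "harmonic_fun_on (\<lambda>z. h z + cnj (g z)) S"
proof -
  \<comment> \<open>the constants \<open>c\<close> and \<open>d\<close> cover the function and both of its partial derivatives\<close>
  have partials: "((\<lambda>z. c * u z + d * cnj (v z)) has_derivative
      (\<lambda>k. Re k *\<^sub>R (c * deriv u z + d * cnj (deriv v z)) +
           Im k *\<^sub>R (c * \<i> * deriv u z - d * \<i> * cnj (deriv v z)))) (at z)"
    if "u holomorphic_on S" "v holomorphic_on S" "z \<in> S" for u v c d z
  proof -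
    have "(u has_field_derivative deriv u z) (at z)" "(v has_field_derivative deriv v z) (at z)"
      using that assms(1) by (auto intro: holomorphic_derivI)
    then have "(u has_derivative (*) (deriv u z)) (at z)" "(v has_derivative (*) (deriv v z)) (at z)"
      by (auto simp: has_field_derivative_def)
    note uv = this(1) bounded_linear.has_derivative[OF bounded_linear_cnj this(2)]
    have "((\<lambda>z. c * u z + d * cnj (v z)) has_derivative
            (\<lambda>k. c * (deriv u z * k) + d * cnj (deriv v z * k))) (at z)"
      using uv by (intro has_derivative_add has_derivative_mult_right) auto
    moreover have "c * (deriv u z * k) + d * cnj (deriv v z * k) =
           Re k *\<^sub>R (c * deriv u z + d * cnj (deriv v z)) +
           Im k *\<^sub>R (c * \<i> * deriv u z - d * \<i> * cnj (deriv v z))" for k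
      by (subst (1 2) complex_eq[of k]) (simp add: scaleR_conv_of_real algebra_simps)
    ultimately show ?thesis by simp
  qed
  have h': "deriv h holomorphic_on S" "deriv g holomorphic_on S"
    and h'': "continuous_on S (deriv (deriv h))" "continuous_on S (deriv (deriv g))"
    using assms by (auto intro!: holomorphic_deriv holomorphic_on_imp_continuous_on)
  define p where "p = (\<lambda>z. deriv h z + cnj (deriv g z))"
  define q where "q = (\<lambda>z. \<i> * deriv h z - \<i> * cnj (deriv g z))"
  define pxx where "pxx = (\<lambda>z. deriv (deriv h) z + cnj (deriv (deriv g) z))"
  define pxy where "pxy = (\<lambda>z. \<i> * deriv (deriv h) z - \<i> * cnj (deriv (deriv g) z))"
  have cont: "continuous_on S pxx" "continuous_on S pxy" "continuous_on S (\<lambda>z. - pxx z)"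
    unfolding pxx_def pxy_def by (intro continuous_intros h'')+
  have d: "((\<lambda>z. h z + cnj (g z)) has_derivative (\<lambda>v. Re v *\<^sub>R p z + Im v *\<^sub>R q z)) (at z)"
    "(p has_derivative (\<lambda>v. Re v *\<^sub>R pxx z + Im v *\<^sub>R pxy z)) (at z)"
    "(q has_derivative (\<lambda>v. Re v *\<^sub>R pxy z + Im v *\<^sub>R - pxx z)) (at z)" if "z \<in> S" for z
  proof -
    show "((\<lambda>z. h z + cnj (g z)) has_derivative (\<lambda>v. Re v *\<^sub>R p z + Im v *\<^sub>R q z)) (at z)"
      using partials[OF assms(2,3) that, of 1 1] by (simp add: p_def q_def)
    show "(p has_derivative (\<lambda>v. Re v *\<^sub>R pxx z + Im v *\<^sub>R pxy z)) (at z)"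
      using partials[OF h' that, of 1 1] by (simp add: p_def pxx_def pxy_def)
    have eq: "\<i> * u + (- \<i>) * v = \<i> * u - \<i> * v" "\<i> * \<i> * u - (- \<i>) * \<i> * v = - (u + v)" for u v
      by (simp_all add: algebra_simps)
    show "(q has_derivative (\<lambda>v. Re v *\<^sub>R pxy z + Im v *\<^sub>R - pxx z)) (at z)"
      using partials[OF h' that, of \<i> "-\<i>"] unfolding eq q_def pxx_def pxy_def .
  qed
  show ?thesis
    unfolding harmonic_fun_on_def
    by (rule conjI[OF assms(1)], rule exI[of _ p], rule exI[of _ q], rule exI[of _ pxx],
        rule exI[of _ pxy], rule exI[of _ pxy], rule exI[of _ "\<lambda>z. - pxx z"])
       (use cont d in simp)
qed

section \<open>Convexity from coefficient bounds\<close>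

text \<open>All estimates below compare a harmonic series with one of its own terms. What is left after
removing the \<open>k\<close>-th analytic term is bounded by what is left of the majorant.\<close>

lemma dominated_by_remaining_mass:
  fixes x y :: "nat \<Rightarrow> complex"
  assumes "x sums X" "y sums Y" "m sums M"
    and le: "\<And>n. norm (x n) + norm (y n) \<le> m n"
  shows "norm (X + cnj Y - x k) \<le> M - norm (x k)"
proof -
  define f where "f = (\<lambda>n. x n + cnj (y n) - (if n = k then x n else 0))"
  define b where "b = (\<lambda>n. m n - (if n = k then norm (x n) else 0))"
  have f: "f sums (X + cnj Y - x k)"
    unfolding f_def using assms by (intro sums_diff sums_add sums_single) (auto simp: sums_cnj)
  have b: "b sums (M - norm (x k))"
    unfolding b_def using assms by (intro sums_diff sums_single) auto
  have "norm (f n) \<le> b n" for n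
    using le[of n] norm_triangle_ineq[of "x n" "cnj (y n)"] by (auto simp: f_def b_def)
  then have "norm (suminf f) \<le> suminf b"
    using b by (intro norm_suminf_le) (auto simp: sums_iff)
  then show ?thesis using f b by (simp add: sums_iff)
qed

text \<open>With \<open>q = N / D\<close> the hypothesis says that \<open>q - \<alpha>\<close> is closer to \<open>1\<close> than to \<open>-1\<close>, which
describes the right half plane. This form of \<open>\<alpha> < Re q\<close> adapts to series, since it only
involves norms of linear combinations of \<open>N\<close> and \<open>D\<close>.\<close>

lemma less_Re_divide_if_closer:
  fixes N D :: complex and \<alpha> :: real
  assumes "norm (N - (1 + \<alpha>) * D) < norm (N + (1 - \<alpha>) * D)"
  shows "\<alpha> < Re (N / D)"
proof -
  have "D \<noteq> 0" using assms by auto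
  define q where "q = N / D"
  have N: "N = q * D" using \<open>D \<noteq> 0\<close> by (simp add: q_def)
  have "norm (q - (1 + \<alpha>)) * norm D < norm (q + (1 - \<alpha>)) * norm D"
    using assms by (simp add: N algebra_simps flip: norm_mult)
  then have "norm (q - (1 + \<alpha>)) < norm (q + (1 - \<alpha>))" using \<open>D \<noteq> 0\<close> by simp
  then have "(norm (q - (1 + \<alpha>)))\<^sup>2 < (norm (q + (1 - \<alpha>)))\<^sup>2"
    by (intro power_strict_mono) auto
  then show ?thesis unfolding cmod_power2 q_def[symmetric] by (simp add: power2_eq_square algebra_simps)
qed

lemma power_diff_le:
  fixes z w :: complex
  assumes "norm z \<le> r" "norm w \<le> r" "0 < r"
  shows "norm (z ^ n - w ^ n) \<le> n * r ^ n * norm (z - w) / r"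
proof -
  have "norm ((z / r) ^ n - (w / r) ^ n) \<le> n * norm (z / r - w / r)"
    using assms by (intro norm_power_diff) (auto simp: norm_divide)
  then have "norm (z ^ n - w ^ n) / r ^ n \<le> n * (norm (z - w) / r)"
    using assms(3) by (simp add: power_divide norm_divide norm_power flip: diff_divide_distrib)
  then show ?thesis using assms(3) by (simp add: divide_simps mult_ac)
qed

text \<open>The classical sufficient condition for convexity of order \<open>\<alpha>\<close> on the circle of radius \<open>r\<close>.
As the term with \<open>A 1 = 1\<close> contributes \<open>(1 - \<alpha>) * r\<close>, it asks that the remaining terms
sum to less than the same amount.\<close>

locale small_coefficients =
  fixes A B :: "nat \<Rightarrow> complex" and \<alpha> r :: real
  assumes conv: "converges_in_unit_disc A" "converges_in_unit_disc B"
    and A1: "A 1 = 1"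
    and \<alpha>: "0 \<le> \<alpha>" "\<alpha> < 1"
    and r: "0 < r" "r < 1"
    and small: "(\<Sum>n. (n * (n - \<alpha>) * norm (A n) + n * (n + \<alpha>) * norm (B n)) * r ^ n) < 2 * (1 - \<alpha>) * r"
begin

definition f :: "complex \<Rightarrow> complex" where
  "f z = power_series A z + cnj (power_series B z)"

text \<open>The tangent of \<open>t \<mapsto> f (r * exp (\<i> * t))\<close> is \<open>\<i> * D\<close>, and its derivative in turn
is \<open>- N\<close>. Hence the tangent direction rotates with speed \<open>Re (N / D)\<close>.\<close>

definition D :: "complex \<Rightarrow> complex" where
  "D z = power_series (euler A) z - cnj (power_series (euler B) z)"

definition N :: "complex \<Rightarrow> complex" where
  "N z = power_series (euler (euler A)) z + cnj (power_series (euler (euler B)) z)"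

definition mass :: "nat \<Rightarrow> real" where
  "mass n = (n * (n - \<alpha>) * norm (A n) + n * (n + \<alpha>) * norm (B n)) * r ^ n"

lemma euler_norm:
  fixes c :: "nat \<Rightarrow> complex"
  shows "norm (euler c n) = n * norm (c n)"
  by (simp add: euler_def norm_mult)

lemma summable_weighted:
  assumes "converges_in_unit_disc (c :: nat \<Rightarrow> complex)"
  shows "summable (\<lambda>n. n * norm (c n) * r ^ n)" "summable (\<lambda>n. n * n * norm (c n) * r ^ n)"
  using summable_norm_power_series[OF converges_euler[OF assms], of r]
    summable_norm_power_series[OF converges_euler[OF converges_euler[OF assms]], of r] r
  by (simp_all add: euler_norm mult.assoc)

lemma summable_mass: "summable mass"
proof -
  have "mass = (\<lambda>n. (n * n * norm (A n) * r ^ n - \<alpha> * (n * norm (A n) * r ^ n)) +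
               (n * n * norm (B n) * r ^ n + \<alpha> * (n * norm (B n) * r ^ n)))"
    by (auto simp: mass_def algebra_simps)
  then show ?thesis
    using summable_weighted conv by (auto intro!: summable_add summable_diff summable_mult)
qed

lemma suminf_mass: "suminf mass < 2 * (1 - \<alpha>) * r"
  using small by (simp add: mass_def[abs_def])

definition slope :: real where
  "slope = (\<Sum>n. n * (norm (A n) + norm (B n)) * r ^ n)"

lemma slope_sums: "(\<lambda>n. n * (norm (A n) + norm (B n)) * r ^ n) sums slope"
  using summable_add[OF summable_weighted(1)[OF conv(1)] summable_weighted(1)[OF conv(2)]]
  by (simp add: slope_def algebra_simps summable_sums)

text \<open>From \<open>1 - \<alpha> \<le> n - \<alpha>\<close> for \<open>n \<ge> 1\<close>: the convexity condition is stronger than the one for univalence.\<close>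

lemma slope_less: "slope < 2 * r"
proof -
  have "(1 - \<alpha>) * slope \<le> suminf mass"
  proof (rule sums_le[OF _ sums_mult[OF slope_sums] summable_sums[OF summable_mass]])
    fix n :: nat
    have "n * (1 - \<alpha>) \<le> n * (n - \<alpha>)" "n * (1 - \<alpha>) \<le> n * (n + \<alpha>)"
      using \<alpha> by (cases n; force intro!: mult_left_mono)+
    then have "(n * (1 - \<alpha>) * norm (A n) + n * (1 - \<alpha>) * norm (B n)) * r ^ n \<le> mass n"
      unfolding mass_def using r by (intro mult_right_mono add_mono) auto
    then show "(1 - \<alpha>) * (n * (norm (A n) + norm (B n)) * r ^ n) \<le> mass n"
      by (simp add: algebra_simps)
  qed
  also have "\<dots> < (1 - \<alpha>) * (2 * r)" using suminf_mass by (simp only: mult_ac)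
  finally show ?thesis using \<alpha> by simp
qed

lemma series_sums:
  fixes c :: "nat \<Rightarrow> complex"
  assumes "converges_in_unit_disc c" "norm z < 1"
  shows "(\<lambda>n. c n * z ^ n) sums power_series c z"
  using assms by (auto simp: converges_in_unit_disc_def intro: summable_sums)

text \<open>On the disc the map differs from the identity by a strict contraction, because the Lipschitz
constant of \<open>f z - z\<close> is at most \<open>slope / r - 1\<close>.\<close>

lemma inj_on_f: "inj_on f (cball 0 r)"
proof (rule inj_onI, rule ccontr)
  fix z w assume zw: "z \<in> cball 0 r" "w \<in> cball 0 r" "f z = f w" "z \<noteq> w"
  define d where "d = norm (z - w)"
  have d: "d > 0" using zw by (simp add: d_def)
  have diff_sums: "(\<lambda>n. c n * (z ^ n - w ^ n)) sums (power_series c z - power_series c w)"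
    if "converges_in_unit_disc c" for c :: "nat \<Rightarrow> complex"
    using sums_diff[OF series_sums[OF that, of z] series_sums[OF that, of w]] zw r
    by (simp add: algebra_simps)
  have "norm (A n * (z ^ n - w ^ n)) + norm (B n * (z ^ n - w ^ n))
          \<le> n * (norm (A n) + norm (B n)) * r ^ n * (d / r)" for n
  proof -
    have "(norm (A n) + norm (B n)) * norm (z ^ n - w ^ n)
            \<le> (norm (A n) + norm (B n)) * (n * r ^ n * norm (z - w) / r)"
      using zw r by (intro mult_left_mono power_diff_le) auto
    then show ?thesis
      unfolding norm_mult d_def by (simp add: distrib_left distrib_right mult_ac add_divide_distrib)
  qed
  from dominated_by_remaining_mass[OF diff_sums[OF conv(1)] diff_sums[OF conv(2)]
      sums_mult2[OF slope_sums] this, of 1]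
  have "norm (f z - f w - (z - w)) \<le> slope * (d / r) - d"
    by (simp add: A1[unfolded One_nat_def] f_def d_def algebra_simps)
  then have "d \<le> slope * (d / r) - d" using zw by (simp add: d_def norm_minus_commute)
  moreover have "slope * (d / r) < 2 * r * (d / r)"
    using slope_less d r by (intro mult_strict_right_mono) auto
  ultimately show False using r by simp
qed

lemma D_close:
  assumes "norm z = r"
  shows "norm (D z - z) < r"
proof -
  have z: "norm z < 1" using assms r by simp
  note s = series_sums[OF converges_euler z]
  have "norm (euler A n * z ^ n) + norm (- (euler B n * z ^ n)) \<le> n * (norm (A n) + norm (B n)) * r ^ n" for n
    by (simp add: norm_mult norm_power euler_norm assms algebra_simps)
  from dominated_by_remaining_mass[OF s[OF conv(1)] sums_minus[OF s[OF conv(2)]] slope_sums this, of 1]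
  have "norm (D z - z) \<le> slope - r"
    using A1 by (simp add: D_def euler_def assms)
  then show ?thesis using slope_less by simp
qed

text \<open>Apply \<open>less_Re_divide_if_closer\<close>. Termwise majorants \<open>m1\<close> of \<open>N - (1 + \<alpha>) * D\<close> and \<open>m2\<close> of
\<open>N + (1 - \<alpha>) * D\<close> add up to twice the mass, apart from the index \<open>1\<close>: there
\<open>\<bar>1 - (1 + \<alpha>)\<bar> = \<alpha>\<close> has the opposite sign, which costs \<open>2 * \<alpha> * r\<close>. The second series
has first term \<open>(2 - \<alpha>) * z\<close>, so its norm is at least \<open>2 * (2 - \<alpha>) * r\<close> minus the sum of
\<open>m2\<close>, and the mass condition is exactly what makes this exceed the sum of \<open>m1\<close>.\<close>

lemma Re_N_div_D:
  assumes "norm z = r"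
  shows "\<alpha> < Re (N z / D z)"
proof (rule less_Re_divide_if_closer)
  have z: "norm z < 1" using assms r by simp
  note s1 = series_sums[OF converges_euler z] 
  note s2 = series_sums[OF converges_euler[OF converges_euler] z]
  have sum: "(\<lambda>n. of_real (n * (n + \<beta>)) * c n * z ^ n) sums
          (power_series (euler (euler c)) z + \<beta> * power_series (euler c) z)"
    if "converges_in_unit_disc c" for c and \<beta> :: real
    using sums_add[OF s2[OF that] sums_mult[OF s1[OF that], of \<beta>]]
    by (simp add: euler_def algebra_simps)
  define m1 where "m1 = (\<lambda>n. (n * \<bar>n - (1 + \<alpha>)\<bar> * norm (A n) + n * \<bar>n + (1 + \<alpha>)\<bar> * norm (B n)) * r ^ n)"
  define m2 where "m2 = (\<lambda>n. (n * \<bar>n + (1 - \<alpha>)\<bar> * norm (A n) + n * \<bar>n - (1 - \<alpha>)\<bar> * norm (B n)) * r ^ n)"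
  have m12: "m1 n + m2 n = 2 * mass n + (if n = 1 then 2 * \<alpha> * r else 0)" for n
  proof -
    consider "n = 0" | "n = 1" | "n \<ge> 2" by linarith
    then show ?thesis
    proof cases
      case 3
      then have "\<bar>n - (1 + \<alpha>)\<bar> = n - (1 + \<alpha>)" "\<bar>n - (1 - \<alpha>)\<bar> = n - (1 - \<alpha>)"
          "\<bar>n + (1 + \<alpha>)\<bar> = n + (1 + \<alpha>)" "\<bar>n + (1 - \<alpha>)\<bar> = n + (1 - \<alpha>)"
        using \<alpha> by auto
      then show ?thesis using 3 by (simp add: m1_def m2_def mass_def algebra_simps)
    qed (use \<alpha> A1 in \<open>auto simp: m1_def m2_def mass_def algebra_simps\<close>)
  qed
  have m_nonneg: "0 \<le> m1 n" "0 \<le> m2 n" for n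
    using r by (auto simp: m1_def m2_def intro!: mult_nonneg_nonneg add_nonneg_nonneg)
  have total: "(\<lambda>n. m1 n + m2 n) sums (2 * suminf mass + 2 * \<alpha> * r)"
    unfolding m12 by (intro sums_add sums_mult summable_sums summable_mass)
       (use sums_single[of 1 "\<lambda>_. 2 * \<alpha> * r"] in simp)
  have summ: "summable m1" "summable m2"
    by (rule summable_comparison_test_ev[OF _ sums_summable[OF total]];
        use m_nonneg in simp)+
  define M1 M2 where "M1 = suminf m1" and "M2 = suminf m2"
  have M: "m1 sums M1" "m2 sums M2" using summ by (auto simp: M1_def M2_def)
  have M12: "M1 + M2 = 2 * suminf mass + 2 * \<alpha> * r"
    using sums_unique2[OF sums_add[OF M] total] .
  have le1: "norm (of_real (n * (n + (- (1 + \<alpha>)))) * A n * z ^ n) +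
        norm (of_real (n * (n + (1 + \<alpha>))) * B n * z ^ n) \<le> m1 n" for n
    unfolding norm_mult norm_power norm_of_real abs_mult assms m1_def by (simp add: algebra_simps)
  have le2: "norm (of_real (n * (n + (1 - \<alpha>))) * A n * z ^ n) +
        norm (of_real (n * (n + (- (1 - \<alpha>)))) * B n * z ^ n) \<le> m2 n" for n
    unfolding norm_mult norm_power norm_of_real abs_mult assms m2_def by (simp add: algebra_simps)
  have eq1: "power_series (euler (euler A)) z + of_real (- (1 + \<alpha>)) * power_series (euler A) z +
      cnj (power_series (euler (euler B)) z + of_real (1 + \<alpha>) * power_series (euler B) z)
      = N z - (1 + \<alpha>) * D z"
    by (simp add: N_def D_def algebra_simps)
  have eq2: "power_series (euler (euler A)) z + of_real (1 - \<alpha>) * power_series (euler A) z +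
      cnj (power_series (euler (euler B)) z + of_real (- (1 - \<alpha>)) * power_series (euler B) z)
      = N z + (1 - \<alpha>) * D z"
    by (simp add: N_def D_def algebra_simps)
  have "norm (N z - (1 + \<alpha>) * D z) \<le> M1"
    using dominated_by_remaining_mass[OF sum[OF conv(1)] sum[OF conv(2)] M(1) le1, of 0]
    unfolding eq1 by simp
  moreover have "norm (N z + (1 - \<alpha>) * D z - (2 - \<alpha>) * z) \<le> M2 - (2 - \<alpha>) * r"
    using dominated_by_remaining_mass[OF sum[OF conv(1)] sum[OF conv(2)] M(2) le2, of 1]
    unfolding eq2 norm_mult norm_power norm_of_real assms using A1 \<alpha> by (simp add: assms)
  moreover have "norm ((2 - \<alpha>) * z) = (2 - \<alpha>) * r"
    using \<alpha> unfolding norm_mult norm_of_real assms by (simp flip: of_real_diff)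
  ultimately show "norm (N z - (1 + \<alpha>) * D z) < norm (N z + (1 - \<alpha>) * D z)"
    using M12 suminf_mass norm_triangle_sub[of "(2 - \<alpha>) * z" "N z + (1 - \<alpha>) * D z"]
    by (simp add: norm_minus_commute algebra_simps)
qed

text \<open>A continuous argument of \<open>\<i> * D\<close>. Rotating \<open>D\<close> back by \<open>- t\<close> keeps it in the right half
plane, where the principal logarithm is smooth; this also shows that the tangent makes
exactly one turn per period.\<close>

definition \<phi> :: "real \<Rightarrow> real" where
  "\<phi> t = pi/2 + t + Im (Ln (D (rcis r t) * cis (-t)))"

lemma f_tangent: "((\<lambda>t. f (rcis r t)) has_vector_derivative \<i> * D (rcis r t)) (at t)"
proof -
  have "((\<lambda>t. f (rcis r t)) has_vector_derivative
      \<i> * power_series (euler A) (rcis r t) + cnj (\<i> * power_series (euler B) (rcis r t))) (at t)"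
    unfolding f_def using r conv
    by (intro has_vector_derivative_add has_vector_derivative_cnj power_series_on_circle) auto
  then show ?thesis by (simp add: D_def algebra_simps)
qed

lemma D_tangent: "((\<lambda>t. D (rcis r t)) has_vector_derivative \<i> * N (rcis r t)) (at t)"
proof -
  have "((\<lambda>t. D (rcis r t)) has_vector_derivative
      \<i> * power_series (euler (euler A)) (rcis r t) - cnj (\<i> * power_series (euler (euler B)) (rcis r t))) (at t)"
    unfolding D_def using r conv
    by (intro has_vector_derivative_diff has_vector_derivative_cnj power_series_on_circle converges_euler) auto
  then show ?thesis by (simp add: N_def algebra_simps)
qed

lemma Re_rotated_D: "0 < Re (D (rcis r t) * cis (-t))"
proof -
  have "norm (D (rcis r t) - rcis r t) < r"
    using r by (intro D_close) simp
  moreover have "D (rcis r t) * cis (-t) - r = (D (rcis r t) - rcis r t) * cis (-t)"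
    by (simp add: rcis_def algebra_simps cis_mult)
  ultimately have "norm (D (rcis r t) * cis (-t) - r) < r" by (simp add: norm_mult)
  then show ?thesis
    using abs_Re_le_cmod[of "D (rcis r t) * cis (-t) - r"] by simp
qed

lemma \<phi>_deriv: "(\<phi> has_real_derivative Re (N (rcis r t) / D (rcis r t))) (at t)"
proof -
  define E where "E = (\<lambda>t. D (rcis r t) * cis (-t))"
  have E0: "E t \<noteq> 0" and nonpos: "E t \<notin> \<real>\<^sub>\<le>\<^sub>0"
    using Re_rotated_D[of t] by (auto simp: E_def complex_nonpos_Reals_iff)
  have "((\<lambda>t. cis (-t)) has_vector_derivative - \<i> * cis (-t)) (at t)"
    unfolding cis_conv_exp
    by (auto intro!: derivative_eq_intros has_vector_derivative_real_field)
  then have "(E has_vector_derivative D (rcis r t) * (- \<i> * cis (-t)) + \<i> * N (rcis r t) * cis (-t)) (at t)"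
    unfolding E_def by (intro has_vector_derivative_mult D_tangent)
  from field_vector_diff_chain_at[OF this has_field_derivative_Ln[OF nonpos]]
  have "((\<lambda>t. Ln (E t)) has_vector_derivative
      (D (rcis r t) * (- \<i> * cis (-t)) + \<i> * N (rcis r t) * cis (-t)) * inverse (E t)) (at t)"
    by (simp add: o_def)
  also have "(D (rcis r t) * (- \<i> * cis (-t)) + \<i> * N (rcis r t) * cis (-t)) * inverse (E t)
      = \<i> * (N (rcis r t) / D (rcis r t) - 1)"
    using E0 by (simp add: E_def field_simps)
  finally have "((\<lambda>t. Im (Ln (E t))) has_vector_derivative Im (\<i> * (N (rcis r t) / D (rcis r t) - 1))) (at t)"
    by (rule bounded_linear.has_vector_derivative[OF bounded_linear_Im])
  then have "((\<lambda>t. Im (Ln (E t))) has_real_derivative Re (N (rcis r t) / D (rcis r t)) - 1) (at t)"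
    by (simp add: has_real_derivative_iff_has_vector_derivative)
  from DERIV_add[OF DERIV_add[OF DERIV_const[of "pi/2"] DERIV_ident] this]
  have "((\<lambda>t. pi/2 + t + Im (Ln (E t))) has_real_derivative Re (N (rcis r t) / D (rcis r t))) (at t)"
    by simp
  then show ?thesis by (simp add: \<phi>_def[abs_def] E_def)
qed

lemma \<phi>_branch: "arg_branch (\<lambda>t. \<i> * D (rcis r t)) \<phi>"
proof -
  have "\<i> * D (rcis r t) = rcis (norm (\<i> * D (rcis r t))) (\<phi> t)" for t
  proof -
    define E where "E = D (rcis r t) * cis (-t)"
    have "E \<noteq> 0" using Re_rotated_D[of t] by (auto simp: E_def)
    then have "E = norm E * cis (Im (Ln E))"
      by (metis exp_Ln exp_eq_polar norm_exp_eq_Re)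
    moreover have "\<i> * D (rcis r t) = cis (pi/2 + t) * E"
      by (simp add: E_def cis_mult flip: cis_pi_half)
    ultimately have "\<i> * D (rcis r t) = cis (pi/2 + t) * (norm E * cis (Im (Ln E)))"
      by metis
    also have "\<dots> = norm E * (cis (pi/2 + t) * cis (Im (Ln E)))" by (simp only: mult_ac)
    also have "\<dots> = rcis (norm E) (\<phi> t)"
      by (simp only: rcis_def \<phi>_def E_def cis_mult)
    also have "norm E = norm (\<i> * D (rcis r t))" by (simp add: E_def norm_mult)
    finally show ?thesis .
  qed
  moreover have "D (rcis r t) \<noteq> 0" for t using Re_rotated_D[of t] by auto
  moreover have "continuous_on UNIV \<phi>"
    using \<phi>_deriv by (meson DERIV_isCont continuous_at_imp_continuous_on)
  ultimately show ?thesis by (auto simp: arg_branch_def)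
qed

lemma image_of_circle_convex: "convex_curve (f ` sphere 0 r)"
proof -
  have circle: "sphere 0 r = range (rcis r)"
  proof safe
    fix z :: complex assume "z \<in> sphere 0 r"
    then show "z \<in> range (rcis r)" using rcis_cmod_Arg[of z] by (metis mem_sphere_0 rangeI)
  qed (use r in auto)
  have per: "rcis r (t + 2*pi) = rcis r t" "cis (- (t + 2*pi)) = cis (- t)" for t
    by (simp_all add: rcis_def complex_eq_iff cos_diff sin_diff)
  have "convex_curve (range (\<lambda>t. f (rcis r t)))"
  proof (rule convex_curve_if_tangent_turns_once[OF f_tangent \<phi>_branch])
    show "strict_mono \<phi>"
    proof (rule strict_monoI)
      fix x y :: real assume "x < y"
      then show "\<phi> x < \<phi> y"
      proof (rule DERIV_pos_imp_increasing[of x y \<phi>])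
        fix t
        have "0 < Re (N (rcis r t) / D (rcis r t))"
          using Re_N_div_D[of "rcis r t"] r \<alpha> by simp
        then show "\<exists>y. (\<phi> has_real_derivative y) (at t) \<and> 0 < y"
          using \<phi>_deriv by blast
      qed
    qed
    show "\<phi> (t + 2*pi) = \<phi> t + 2*pi" for t by (simp only: \<phi>_def per)
  qed (simp add: per)
  then show ?thesis by (simp add: circle image_image)
qed
end

lemma convexity_on_circle:
  assumes "small_coefficients A B \<alpha> r"
    and F: "\<And>z. norm z < 1 \<Longrightarrow> F z = power_series A z + cnj (power_series B z)"
  shows "inj_on F (cball 0 r)" "convex_curve (F ` sphere 0 r)"
    "\<exists>\<phi>. arg_branch (circle_deriv F r) \<phi> \<and> (\<forall>\<theta>. \<phi> differentiable (at \<theta>) \<and> deriv \<phi> \<theta> > \<alpha>)"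
proof -
  interpret small_coefficients A B \<alpha> r by fact
  have eq: "F z = f z" if "norm z < 1" for z using F[OF that] by (simp add: f_def)
  show "inj_on F (cball 0 r)"
    using inj_on_f r by (subst inj_on_cong[of _ _ f]) (auto intro!: eq)
  have "F ` sphere 0 r = f ` sphere 0 r"
    using r by (intro image_cong) (auto intro!: eq)
  then show "convex_curve (F ` sphere 0 r)" using image_of_circle_convex by simp
  have "(\<lambda>t. F (rcis r t)) = (\<lambda>t. f (rcis r t))" using r by (auto intro!: eq)
  then have "circle_deriv F r = (\<lambda>t. \<i> * D (rcis r t))"
    using f_tangent by (auto simp: circle_deriv_def vector_derivative_at)
  moreover have "\<alpha> < deriv \<phi> t" "\<phi> differentiable (at t)" for t
    using \<phi>_deriv[of t] Re_N_div_D[of "rcis r t"] r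
    by (auto simp: DERIV_imp_deriv real_differentiable_def)
  ultimately show "\<exists>\<phi>. arg_branch (circle_deriv F r) \<phi> \<and> (\<forall>\<theta>. \<phi> differentiable (at \<theta>) \<and> deriv \<phi> \<theta> > \<alpha>)"
    using \<phi>_branch by auto
qed

section \<open>The radius equation\<close>


text \<open>A known closed form of a power series is turned into one for the series with coefficients
\<open>n * c n\<close>. Repeated use on the geometric series gives the power sums below.\<close>

lemma euler_sums:
  fixes x :: real
  assumes "\<And>x. \<bar>x\<bar> < 1 \<Longrightarrow> (\<lambda>n. c n * x ^ n) sums F x"
    and "(F has_field_derivative F') (at x)" and "\<bar>x\<bar> < 1"
  shows "(\<lambda>n. euler c n * x ^ n) sums (x * F')"
  using assms by (intro euler_sums_if_diffs_sums termdiffs_sums_strong[of 1]) auto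

lemma power_sums:
  fixes x :: real
  assumes x: "\<bar>x\<bar> < 1"
  shows "(\<lambda>n. real n ^ 2 * x ^ n) sums (x * (1 + x) / (1 - x) ^ 3)"
    and "(\<lambda>n. real n ^ 4 * x ^ n) sums (x * (1 + x) * (x^2 + 10 * x + 1) / (1 - x) ^ 5)"
proof -
  have d: "((\<lambda>x. 1 / (1 - x)) has_real_derivative 1 / (1 - x) ^ 2) (at x)"
    "((\<lambda>x. x / (1 - x) ^ 2) has_real_derivative (1 + x) / (1 - x) ^ 3) (at x)"
    "((\<lambda>x. x * (1 + x) / (1 - x) ^ 3) has_real_derivative (x^2 + 4 * x + 1) / (1 - x) ^ 4) (at x)"
    "((\<lambda>x. x * (x^2 + 4 * x + 1) / (1 - x) ^ 4) has_real_derivative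
       (1 + x) * (x^2 + 10 * x + 1) / (1 - x) ^ 5) (at x)" if "\<bar>x\<bar> < 1" for x :: real
  proof -
    \<comment> \<open>with \<open>u\<close> as the variable all denominators are monomials\<close>
    define u where "u = 1 - x"
    have u: "u \<noteq> 0" "1 - x = u" "x = 1 - u" using that by (auto simp: u_def)
    show "((\<lambda>x. 1 / (1 - x)) has_real_derivative 1 / (1 - x) ^ 2) (at x)"
      using u(1) unfolding u_def by (auto intro!: derivative_eq_intros simp: power2_eq_square)
    show "((\<lambda>x. x / (1 - x) ^ 2) has_real_derivative (1 + x) / (1 - x) ^ 3) (at x)"
      by (rule derivative_eq_intros refl | simp add: u)+
         (use u(1) in \<open>simp add: u field_simps eval_nat_numeral\<close>)
    show "((\<lambda>x. x * (1 + x) / (1 - x) ^ 3) has_real_derivative (x^2 + 4 * x + 1) / (1 - x) ^ 4) (at x)"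
      by (rule derivative_eq_intros refl | simp add: u)+
         (use u(1) in \<open>simp add: u field_simps eval_nat_numeral\<close>)
    show "((\<lambda>x. x * (x^2 + 4 * x + 1) / (1 - x) ^ 4) has_real_derivative
       (1 + x) * (x^2 + 10 * x + 1) / (1 - x) ^ 5) (at x)"
      by (rule derivative_eq_intros refl | simp add: u)+
         (use u(1) in \<open>simp add: u field_simps eval_nat_numeral\<close>)
  qed
  have "(\<lambda>n. euler (\<lambda>_. 1) n * x ^ n) sums (x * (1 / (1 - x) ^ 2))" if "\<bar>x\<bar> < 1" for x :: real
    by (rule euler_sums[OF _ d(1)]) (use that in \<open>auto simp: geometric_sums\<close>)
  then have s1: "(\<lambda>n. real n * x ^ n) sums (x / (1 - x) ^ 2)" if "\<bar>x\<bar> < 1" for x :: real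
    using that by (simp add: euler_def)
  have "(\<lambda>n. euler (\<lambda>n. real n) n * x ^ n) sums (x * ((1 + x) / (1 - x) ^ 3))"
    if "\<bar>x\<bar> < 1" for x :: real
    by (rule euler_sums[OF s1 d(2)]) (use that in auto)
  then have s2: "(\<lambda>n. real n ^ 2 * x ^ n) sums (x * (1 + x) / (1 - x) ^ 3)" if "\<bar>x\<bar> < 1" for x :: real
    using that by (simp add: euler_def power2_eq_square)
  show "(\<lambda>n. real n ^ 2 * x ^ n) sums (x * (1 + x) / (1 - x) ^ 3)" by (rule s2[OF x])
  have "(\<lambda>n. euler (\<lambda>n. real n ^ 2) n * x ^ n) sums (x * ((x^2 + 4 * x + 1) / (1 - x) ^ 4))"
    if "\<bar>x\<bar> < 1" for x :: real
    by (rule euler_sums[OF s2 d(3)]) (use that in auto)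
  then have s3: "(\<lambda>n. real n ^ 3 * x ^ n) sums (x * (x^2 + 4 * x + 1) / (1 - x) ^ 4)"
    if "\<bar>x\<bar> < 1" for x :: real
    using that by (simp add: euler_def power2_eq_square power3_eq_cube mult.assoc)
  have "(\<lambda>n. euler (\<lambda>n. real n ^ 3) n * x ^ n) sums (x * ((1 + x) * (x^2 + 10 * x + 1) / (1 - x) ^ 5))"
    by (rule euler_sums[OF s3 d(4)]) (use x in auto)
  then show "(\<lambda>n. real n ^ 4 * x ^ n) sums (x * (1 + x) * (x^2 + 10 * x + 1) / (1 - x) ^ 5)"
    by (simp add: euler_def eval_nat_numeral mult.assoc)
qed

text \<open>The left-hand side of the radius equation. Positivity at \<open>r\<close> is the condition in
\<open>small_coefficients\<close> for the extremal coefficients, multiplied by \<open>(1 - r)^5 / r\<close>.\<close>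

definition rC_poly :: "real \<Rightarrow> real \<Rightarrow> real" where
  "rC_poly \<alpha> r = 2 * (1 - \<alpha>) * (1 - r)^5 + \<alpha> * (1 + r) * (1 - r)^2 - (1 + r) * (r^2 + 6 * r + 1)"

text \<open>Each summand is non-increasing on the unit interval, the last one strictly decreasing; for the middle
one this is visible from \<open>(1 + r) * (1 - r)^2 = (1 - r) * (1 - r^2)\<close>.\<close>

lemma rC_poly_strict_antimono:
  assumes "0 \<le> \<alpha>" "\<alpha> < 1" "0 \<le> x" "x < y" "y \<le> 1"
  shows "rC_poly \<alpha> y < rC_poly \<alpha> x"
proof -
  have "(1 - y)^5 \<le> (1 - x)^5" using assms by (intro power_mono) auto
  moreover have "(1 - y) * (1 - y\<^sup>2) \<le> (1 - x) * (1 - x\<^sup>2)"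
    using assms by (intro mult_mono diff_left_mono power_mono) (auto simp: power_le_one)
  moreover have "(1 + x) * (x^2 + 6 * x + 1) < (1 + y) * (y^2 + 6 * y + 1)"
  proof -
    have "x\<^sup>2 \<le> y\<^sup>2" using assms by (intro power_mono) auto
    then have "x\<^sup>2 + 6 * x + 1 < y\<^sup>2 + 6 * y + 1" using assms by linarith
    then show ?thesis using assms by (intro mult_strict_mono) (auto intro: add_nonneg_pos)
  qed
  moreover from calculation(1,2)
  have "2 * (1 - \<alpha>) * (1 - y)^5 \<le> 2 * (1 - \<alpha>) * (1 - x)^5"
    "\<alpha> * ((1 - y) * (1 - y\<^sup>2)) \<le> \<alpha> * ((1 - x) * (1 - x\<^sup>2))"
    using assms by (auto intro: mult_left_mono)
  ultimately have "2 * (1 - \<alpha>) * (1 - y)^5 + \<alpha> * ((1 - y) * (1 - y\<^sup>2)) - (1 + y) * (y^2 + 6 * y + 1)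
     < 2 * (1 - \<alpha>) * (1 - x)^5 + \<alpha> * ((1 - x) * (1 - x\<^sup>2)) - (1 + x) * (x^2 + 6 * x + 1)"
    by linarith
  then show ?thesis by (simp add: rC_poly_def power2_eq_square algebra_simps)
qed

lemma rC_root:
  assumes "0 \<le> \<alpha>" "\<alpha> < 1"
  shows "\<exists>!r. is_rC \<alpha> r" "0 < rC \<alpha>" "rC \<alpha> < 1" "rC_poly \<alpha> (rC \<alpha>) = 0"
proof -
  have "\<exists>r\<ge>0. r \<le> 1 \<and> rC_poly \<alpha> r = 0"
    using assms by (intro IVT2') (auto simp: rC_poly_def intro!: continuous_intros)
  then obtain r where r: "0 \<le> r" "r \<le> 1" "rC_poly \<alpha> r = 0" by blast
  have "r \<noteq> 0" "r \<noteq> 1" using r(3) assms by (auto simp: rC_poly_def)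
  then have "is_rC \<alpha> r" using r by (auto simp: is_rC_def rC_poly_def)
  moreover have "s = r" if "is_rC \<alpha> s" for s
    using that r rC_poly_strict_antimono[OF assms, of r s] rC_poly_strict_antimono[OF assms, of s r]
    by (cases r s rule: linorder_cases) (auto simp: is_rC_def rC_poly_def)
  ultimately show ex: "\<exists>!r. is_rC \<alpha> r" by blast
  show "0 < rC \<alpha>" "rC \<alpha> < 1" "rC_poly \<alpha> (rC \<alpha>) = 0"
    using theI'[OF ex] by (simp_all add: rC_def is_rC_def rC_poly_def)
qed

lemma rC_0_approx: "\<bar>rC 0 - 0.0614313\<bar> \<le> 0.00000005"
proof -
  note root = rC_root[of 0, simplified]
  have "rC_poly 0 0.06143125 > 0" "rC_poly 0 0.06143135 < 0"
    by (simp_all add: rC_poly_def field_simps)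
  then have "0.06143125 \<le> rC 0" "rC 0 \<le> 0.06143135"
    using rC_poly_strict_antimono[of 0 "rC 0" "0.06143125"]
      rC_poly_strict_antimono[of 0 "0.06143135" "rC 0"] root
    by (force simp: not_le[symmetric])+
  then show ?thesis by (simp add: abs_if)
qed

text \<open>For the extremal coefficients the sum in the coefficient condition is computable: the two bounds have the
sum \<open>(2 * n^2 + 1) / 3\<close> and the difference \<open>n\<close>, which gives \<open>n^2 * (2 * n^2 + 1) / 3 - \<alpha> * n^2\<close> as weight of \<open>r^n\<close>. The total is
smaller than \<open>2 * (1 - \<alpha>) * r\<close> exactly when \<open>rC_poly \<alpha> r > 0\<close>, that is, when \<open>r\<close> is below the root.\<close>

lemma coefficient_condition:
  assumes \<alpha>: "0 \<le> \<alpha>" "\<alpha> < 1"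
    and A: "A 0 = 0" "A 1 = 1" "B 0 = 0"
      "\<And>n. n \<ge> 1 \<Longrightarrow> norm (A n) \<le> 1/6 * (2 * real n + 1) * (real n + 1)"
      "\<And>n. n \<ge> 1 \<Longrightarrow> norm (B n) \<le> 1/6 * (2 * real n - 1) * (real n - 1)"
    and r: "0 < r" "r < rC \<alpha>"
  shows "small_coefficients A B \<alpha> r"
proof -
  have r1: "r < 1" using r rC_root[OF \<alpha>] by simp
  have le: "norm (A n) \<le> real n ^ 2" "norm (B n) \<le> real n ^ 2" for n
  proof -
    have "norm (A n) \<le> real n ^ 2 \<and> norm (B n) \<le> real n ^ 2"
    proof (cases "n = 0")
      case False
      then have "1 \<le> real n" "real n \<le> real n * real n" by simp_all
      moreover from False have "norm (A n) \<le> 1/6 * (2 * real n + 1) * (real n + 1)"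
        "norm (B n) \<le> 1/6 * (2 * real n - 1) * (real n - 1)"
        using A(4,5)[of n] by auto
      moreover have
        "1/6 * (2 * real n + 1) * (real n + 1) = 1/3 * (real n * real n) + 1/2 * real n + 1/6"
        "1/6 * (2 * real n - 1) * (real n - 1) = 1/3 * (real n * real n) - 1/2 * real n + 1/6"
        by (simp_all add: field_simps)
      ultimately show ?thesis unfolding power2_eq_square by linarith
    qed (use A in simp)
    then show "norm (A n) \<le> real n ^ 2" "norm (B n) \<le> real n ^ 2" by auto
  qed
  have conv: "converges_in_unit_disc c" if "\<And>n. norm (c n) \<le> real n ^ 2" for c :: "nat \<Rightarrow> complex"
    unfolding converges_in_unit_disc_def
  proof safe
    fix z :: complex assume "norm z < 1"
    then have "summable (\<lambda>n. real n ^ 2 * norm z ^ n)"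
      using power_sums(1)[of "norm z"] by (auto simp: sums_iff)
    then show "summable (\<lambda>n. c n * z ^ n)"
      by (rule summable_comparison_test')
         (auto simp: norm_mult norm_power intro!: mult_right_mono that)
  qed
  let ?m = "\<lambda>n. (n * (n - \<alpha>) * norm (A n) + n * (n + \<alpha>) * norm (B n)) * r ^ n"
  let ?M = "\<lambda>n. 2/3 * (real n ^ 4 * r ^ n) + (1/3 - \<alpha>) * (real n ^ 2 * r ^ n)"
  have m_le: "?m n \<le> ?M n" for n
  proof (cases "n = 0")
    case False
    have "n * (n - \<alpha>) * norm (A n) + n * (n + \<alpha>) * norm (B n)
        \<le> n * (n - \<alpha>) * (1/6 * (2 * real n + 1) * (real n + 1)) +
          n * (n + \<alpha>) * (1/6 * (2 * real n - 1) * (real n - 1))"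
      using False \<alpha> A(4,5)[of n] by (intro add_mono mult_left_mono) auto
    also have "\<dots> = 2/3 * real n ^ 4 + (1/3 - \<alpha>) * real n ^ 2"
      by (simp add: field_simps eval_nat_numeral)
    finally have "?m n \<le> (2/3 * real n ^ 4 + (1/3 - \<alpha>) * real n ^ 2) * r ^ n"
      using r by (intro mult_right_mono) auto
    then show ?thesis by (simp add: algebra_simps)
  qed simp
  have m_nonneg: "0 \<le> ?m n" for n
    using r \<alpha> by (cases n) (auto intro!: mult_nonneg_nonneg add_nonneg_nonneg)
  let ?S = "2/3 * (r * (1 + r) * (r^2 + 10 * r + 1) / (1 - r) ^ 5) + (1/3 - \<alpha>) * (r * (1 + r) / (1 - r) ^ 3)"
  have M: "?M sums ?S"
    using r r1 by (intro sums_add sums_mult power_sums) auto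
  have "summable ?m"
    using m_le m_nonneg by (intro summable_comparison_test'[OF sums_summable[OF M], of 0]) auto
  then have "suminf ?m \<le> ?S" using sums_le[OF m_le summable_sums M] by simp
  also have "\<dots> < 2 * (1 - \<alpha>) * r"
  proof -
    have "0 < rC_poly \<alpha> r"
      using rC_poly_strict_antimono[OF \<alpha>, of r "rC \<alpha>"] rC_root[OF \<alpha>] r by simp
    then have "0 < r * rC_poly \<alpha> r / (1 - r) ^ 5" using r r1 by simp
    also have "\<dots> = 2 * (1 - \<alpha>) * r - ?S"
      using r1 unfolding rC_poly_def by (simp add: divide_simps) algebra
    finally show ?thesis by simp
  qed
  finally show ?thesis
    using A \<alpha> r r1 le conv by unfold_locales auto
qed

lemma univalent_and_fully_convex:
  assumes \<alpha>: "0 \<le> \<alpha>" "\<alpha> < 1"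
    and A: "A 0 = 0" "A 1 = 1" "B 0 = 0"
      "\<And>n. n \<ge> 1 \<Longrightarrow> norm (A n) \<le> 1/6 * (2 * real n + 1) * (real n + 1)"
      "\<And>n. n \<ge> 1 \<Longrightarrow> norm (B n) \<le> 1/6 * (2 * real n - 1) * (real n - 1)"
    and h: "\<And>z. norm z < 1 \<Longrightarrow> h z = power_series A z"
    and g: "\<And>z. norm z < 1 \<Longrightarrow> g z = power_series B z"
  shows "inj_on (\<lambda>z. h z + cnj (g z)) (ball 0 (rC \<alpha>))"
    and "fully_convex_of_order \<alpha> (\<lambda>z. h z + cnj (g z)) (rC \<alpha>)"
proof -
  let ?f = "\<lambda>z. h z + cnj (g z)"
  note root = rC_root[OF \<alpha>]
  have small: "small_coefficients A B \<alpha> r" if "0 < r" "r < rC \<alpha>" for r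
    using that by (intro coefficient_condition \<alpha> A)
  have at_r: "inj_on ?f (cball 0 r)" "convex_curve (?f ` sphere 0 r)"
    "\<exists>\<phi>. arg_branch (circle_deriv ?f r) \<phi> \<and> (\<forall>\<theta>. \<phi> differentiable (at \<theta>) \<and> deriv \<phi> \<theta> > \<alpha>)"
    if "0 < r" "r < rC \<alpha>" for r
    using convexity_on_circle[OF small[OF that], of ?f] h g by auto
  show "inj_on ?f (ball 0 (rC \<alpha>))"
  proof (rule inj_onI)
    fix z w assume zw: "z \<in> ball 0 (rC \<alpha>)" "w \<in> ball 0 (rC \<alpha>)" "?f z = ?f w"
    then obtain r where "max (norm z) (norm w) < r" "r < rC \<alpha>"
      using dense[of "max (norm z) (norm w)" "rC \<alpha>"] by auto
    moreover from this have "0 < r" using norm_ge_zero[of z] by linarith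
    ultimately show "z = w" using at_r(1)[of r] zw by (auto dest: inj_onD)
  qed
  have "converges_in_unit_disc A" "converges_in_unit_disc B"
    using small[of "rC \<alpha> / 2"] root by (auto simp: small_coefficients_def)
  then have "power_series A holomorphic_on ball 0 1" "power_series B holomorphic_on ball 0 1"
    by (auto intro: power_series_holomorphic_on_disc)
  then have "h holomorphic_on ball 0 1" "g holomorphic_on ball 0 1"
    using holomorphic_transform[of "power_series A" "ball 0 1" h]
      holomorphic_transform[of "power_series B" "ball 0 1" g] h g by auto
  then have "harmonic_fun_on ?f (ball 0 (rC \<alpha>))"
    using root by (intro harmonic_fun_on_holomorphic_plus_cnj)
       (auto elim!: holomorphic_on_subset intro!: subset_ball)
  moreover have "inj_on ?f (sphere 0 r)" if "0 < r" "r < rC \<alpha>" for r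
    using inj_on_subset[OF at_r(1)[OF that] sphere_cball] .
  ultimately show "fully_convex_of_order \<alpha> ?f (rC \<alpha>)"
    unfolding fully_convex_of_order_def using at_r(2,3) by blast
qed

theorem theorem3p3:
  fixes \<alpha> :: real and a b :: "nat \<Rightarrow> complex" and h g :: "complex \<Rightarrow> complex"
  assumes "0 \<le> \<alpha>" and "\<alpha> < 1"
    and "\<And>z. norm z < 1 \<Longrightarrow> h z = z + (\<Sum>n. a (n + 2) * z ^ (n + 2))"
    and "\<And>z. norm z < 1 \<Longrightarrow> g z = (\<Sum>n. b (n + 1) * z ^ (n + 1))"
    and "a 1 = 1"
    and "\<And>n. n \<ge> 1 \<Longrightarrow> norm (a n) \<le> 1/6 * (2 * real n + 1) * (real n + 1)"
    and "\<And>n. n \<ge> 1 \<Longrightarrow> norm (b n) \<le> 1/6 * (2 * real n - 1) * (real n - 1)"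
  shows "(\<exists>!r. is_rC \<alpha> r) \<and>
         inj_on (\<lambda>z. h z + cnj (g z)) (ball 0 (rC \<alpha>)) \<and>
         fully_convex_of_order \<alpha> (\<lambda>z. h z + cnj (g z)) (rC \<alpha>) \<and>
         (\<exists>!r. is_rC 0 r) \<and>
         inj_on (\<lambda>z. h z + cnj (g z)) (ball 0 (rC 0)) \<and>
         fully_convex (\<lambda>z. h z + cnj (g z)) (rC 0) \<and>
         \<bar>rC 0 - 0.0614313\<bar> \<le> 0.00000005"
proof -
  \<comment> \<open>the series start at index \<open>1\<close>, so \<open>a 0\<close> and \<open>b 0\<close> are arbitrary and get replaced by \<open>0\<close>\<close>
  define A where "A = (\<lambda>n. if n = 0 then 0 else a n)"
  define B where "B = (\<lambda>n. if n = 0 then 0 else b n)"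
  have AB: "A 0 = 0" "A 1 = 1" "B 0 = 0"
    "norm (A n) \<le> 1/6 * (2 * real n + 1) * (real n + 1)"
    "norm (B n) \<le> 1/6 * (2 * real n - 1) * (real n - 1)" if "n \<ge> 1" for n
    using assms(5-7) that by (auto simp: A_def B_def)
  note AB = AB(1-3)[OF order_refl] AB(4,5)
  \<comment> \<open>any admissible radius would do: only the convergence of both series is extracted\<close>
  have "small_coefficients A B 0 (rC 0 / 2)"
    using rC_root[of 0] by (intro coefficient_condition AB) auto
  then have conv: "summable (\<lambda>n. A n * z ^ n)" "summable (\<lambda>n. B n * z ^ n)" if "norm z < 1" for z
    using that by (auto simp: small_coefficients_def converges_in_unit_disc_def)
  have h: "h z = power_series A z" if "norm z < 1" for z
    using assms(3)[OF that] suminf_split_initial_segment[OF conv(1)[OF that], of 2] assms(5)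
    by (simp add: A_def eval_nat_numeral)
  have g: "g z = power_series B z" if "norm z < 1" for z
    using assms(4)[OF that] suminf_split_initial_segment[OF conv(2)[OF that], of 1]
    by (simp add: B_def)
  have main: "inj_on (\<lambda>z. h z + cnj (g z)) (ball 0 (rC \<beta>))"
    "fully_convex_of_order \<beta> (\<lambda>z. h z + cnj (g z)) (rC \<beta>)" if "0 \<le> \<beta>" "\<beta> < 1" for \<beta>
    by (rule univalent_and_fully_convex[of \<beta> A B], use that AB h g in auto)+
  show ?thesis
    using main[of \<alpha>] main[of 0] rC_root(1)[of \<alpha>] rC_root(1)[of 0] rC_0_approx assms(1,2) by simp
qed

end
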